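(* Let $N\ge3$ be an integer, $p\ge q\ge1$, $pq>1$, and let $(u_1,u_2)$ be any supersolution (with no condition of sign) of the system $$-\Delta u_1=|\nabla u_2|^p,\qquad -\Delta u_2=|\nabla u_1|^q$$ in a domain $\Omega\subset\mathbb{R}^N$. (i) If $\Omega=B_{r_0}\setminus\{0\}$ (resp. $\Omega=\mathbb{R}^N\setminus\overline{B_{r_0}}$), then there exists $C=C(N,p,q)>0$ such that for any $0<R<\frac{r_0}2$ (resp. $R>2r_0$), $$\int_{\frac R2\le|x|\le\frac{3R}2}|\nabla u_2|^p\,dx\le C\,R^{N-\frac{p(q+1)}{pq-1}},\qquad \int_{\frac R2\le|x|\le\frac{3R}2}|\nabla u_1|^q\,dx\le C\,R^{N-\frac{q(p+1)}{pq-1}} .$$ (ii) If $\Omega=\mathbb{R}^N$ and $(N-1)pq<\max(N+p,N+q)=N+p$ (that is, $q<\frac{N+p}{(N-1)p}$), then all the solutions of the system are constant.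
   Context: A supersolution in $\Omega$ is a couple of $C^2(\Omega)$ functions with $-\Delta u_1\ge|\nabla u_2|^p$ and $-\Delta u_2\ge|\nabla u_1|^q$ in $\Omega$; a solution satisfies equalities. $B_{r_0}$ is the ball with center $0$ and radius $r_0>0$.
   Formalization: In the exterior case of (i), C = C(N,p,q) for all R > 2r_0 is replaced by: for each κ > 2 a C = C(N,p,q,κ) for all R > κr_0; the printed form fails for N=3, p=q=2, u_1=u_2=ln(1−r_0/|x|) as R decreases to 2r_0. *)

theory Defs
  imports "HOL-Analysis.Analysis"
begin

definition partial_deriv :: "'n::finite \<Rightarrow> (real^'n \<Rightarrow> real) \<Rightarrow> real^'n \<Rightarrow> real"
  where "partial_deriv i u x = frechet_derivative u (at x) (axis i 1)"

definition grad :: "(real^'n::finite \<Rightarrow> real) \<Rightarrow> real^'n \<Rightarrow> real^'n"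
  where "grad u x = (\<chi> i. partial_deriv i u x)"

definition laplacian :: "(real^'n::finite \<Rightarrow> real) \<Rightarrow> real^'n \<Rightarrow> real"
  where "laplacian u x = (\<Sum>i\<in>UNIV. partial_deriv i (partial_deriv i u) x)"

(* The definitions of C^1 and C^2 are meant for open sets only; the derivatives are
   taken in the whole space, and the values of u outside the open set play no role. *)
definition C1_on :: "(real^'n::finite) set \<Rightarrow> (real^'n \<Rightarrow> real) \<Rightarrow> bool"
  where "C1_on \<Omega> u \<longleftrightarrow>
    (\<forall>x\<in>\<Omega>. u differentiable (at x)) \<and> (\<forall>i. continuous_on \<Omega> (partial_deriv i u))"

definition C2_on :: "(real^'n::finite) set \<Rightarrow> (real^'n \<Rightarrow> real) \<Rightarrow> bool"
  where "C2_on \<Omega> u \<longleftrightarrow> C1_on \<Omega> u \<and> (\<forall>i. C1_on \<Omega> (partial_deriv i u))"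

definition supersolution ::
    "real \<Rightarrow> real \<Rightarrow> (real^'n::finite) set \<Rightarrow> (real^'n \<Rightarrow> real) \<Rightarrow> (real^'n \<Rightarrow> real) \<Rightarrow> bool"
  where "supersolution p q \<Omega> u1 u2 \<longleftrightarrow>
    C2_on \<Omega> u1 \<and> C2_on \<Omega> u2 \<and>
    (\<forall>x\<in>\<Omega>. - laplacian u1 x \<ge> norm (grad u2 x) powr p \<and>
            - laplacian u2 x \<ge> norm (grad u1 x) powr q)"

definition solution ::
    "real \<Rightarrow> real \<Rightarrow> (real^'n::finite) set \<Rightarrow> (real^'n \<Rightarrow> real) \<Rightarrow> (real^'n \<Rightarrow> real) \<Rightarrow> bool"
  where "solution p q \<Omega> u1 u2 \<longleftrightarrow>
    C2_on \<Omega> u1 \<and> C2_on \<Omega> u2 \<and>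
    (\<forall>x\<in>\<Omega>. - laplacian u1 x = norm (grad u2 x) powr p \<and>
            - laplacian u2 x = norm (grad u1 x) powr q)"

(* For supersolutions the integrand is continuous on the compact annulus inside the domain,
   so the Bochner integral is a genuine one there (not the default value 0).

   In an exterior domain R > 2 r0 does not suffice for a constant independent of r0 and R:
   for N = 3, p = q = 2 and u1 = u2 = ln (1 - r0 / |x|), an exact solution for |x| > r0,
   the integrals tend to infinity as R decreases to 2 r0. The exterior estimate is therefore
   stated for R > kappa r0, for every kappa > 2, with a constant that may depend on kappa. *)
definition annulus_integral :: "real \<Rightarrow> (real^'n::finite \<Rightarrow> real) \<Rightarrow> real"
  where "annulus_integral R f =
    (LINT x:{x. R / 2 \<le> norm x \<and> norm x \<le> 3 * R / 2}|lborel. f x)"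

end

theory Submission
  imports Defs
begin

text \<open>
  Multiplying \<open>- \<Delta> u1 \<ge> |\<nabla> u2|^p\<close> by a power of a cutoff \<open>\<phi>\<close> and integrating by parts once
  bounds the energy \<open>X = \<integral> |\<nabla> u2|^p \<phi>^(m + 2)\<close> by a first moment of \<open>|\<nabla> u1|\<close>, weighted by
  \<open>\<phi>^(m + 1) |\<nabla> \<phi>|\<close>; the other inequality bounds \<open>Y = \<integral> |\<nabla> u1|^q \<phi>^(m + 1)\<close> by a first moment
  of \<open>|\<nabla> u2|\<close> in the same way. Each first moment
  is controlled by the other energy through \<open>t \<le> a + a^(1 - r) t^r\<close>, a version of Young's inequality with a free
  threshold \<open>a\<close>. As \<open>pq > 1\<close> and \<open>p \<ge> q\<close> force \<open>p > 1\<close>, the coupled pair of inequalities closes: a large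
  threshold in the second one makes the product of the two feedback constants \<open>1 / 2\<close>.

  On the scale \<open>R\<close> the cutoff has gradient of order \<open>1 / R\<close> on a set of volume of order \<open>R^N\<close>, and
  the natural thresholds are \<open>|\<nabla> u1| \<sim> R^(- s)\<close> and \<open>|\<nabla> u2| \<sim> R^(- t)\<close> with
  \<open>s + 1 = p t\<close> and \<open>t + 1 = q s\<close>, that is \<open>s = (p + 1) / (pq - 1)\<close> and \<open>t = (q + 1) / (pq - 1)\<close>.
  With these all powers of \<open>R\<close> cancel except \<open>R^(N - p t)\<close> and \<open>R^(N - q s)\<close>. This is
  \<open>rescaled_energy_estimate\<close>, for a radial cutoff that may live on an annulus or on a ball.

  Annuli inside the punctured ball or the exterior domain give the local estimates. For an entire
  solution the cutoff lives on balls, and \<open>(N - 1) p q < N + p\<close> says exactly that \<open>N - p t < 0\<close>: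
  letting \<open>R\<close> tend to infinity forces \<open>\<nabla> u2 = 0\<close>, and then the second equation gives
  \<open>\<nabla> u1 = 0\<close>.
\<close>

section \<open>Continuously differentiable functions on Euclidean space\<close>

lemma frechet_derivative_eq_grad:
  assumes "u differentiable (at x)"
  shows "frechet_derivative u (at x) h = grad u x \<bullet> h"
proof -
  have lin: "linear (frechet_derivative u (at x))"
    using assms by (rule linear_frechet_derivative)
  have "frechet_derivative u (at x) h = (\<Sum>i\<in>UNIV. h $ i * frechet_derivative u (at x) (axis i 1))"
    by (subst basis_expansion[symmetric, of h])
      (simp add: linear_sum[OF lin] linear_scale[OF lin] scalar_mult_eq_scaleR)
  also have "\<dots> = grad u x \<bullet> h"
    by (simp add: grad_def partial_deriv_def inner_vec_def mult.commute)
  finally show ?thesis .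
qed

lemma has_derivative_grad:
  assumes "u differentiable (at x)"
  shows "(u has_derivative (\<lambda>h. grad u x \<bullet> h)) (at x)"
proof -
  have "frechet_derivative u (at x) = (\<lambda>h. grad u x \<bullet> h)"
    using frechet_derivative_eq_grad[OF assms] by blast
  then show ?thesis using assms frechet_derivative_works by metis
qed

lemma grad_eqI:
  assumes "(u has_derivative (\<lambda>h. v \<bullet> h)) (at x)"
  shows "grad u x = v"
proof -
  have "frechet_derivative u (at x) = (\<lambda>h. v \<bullet> h)"
    using frechet_derivative_at[OF assms] by simp
  then show ?thesis
    by (simp add: grad_def partial_deriv_def vec_eq_iff inner_axis)
qed

lemma grad_nth [simp]: "grad u x $ i = partial_deriv i u x"
  by (simp add: grad_def)

lemma continuous_on_grad:
  assumes "C1_on \<Omega> u" shows "continuous_on \<Omega> (grad u)"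
  using assms unfolding C1_on_def grad_def by (auto intro!: continuous_on_vec_lambda)

lemma C1_onI:
  assumes der: "\<And>x. x \<in> \<Omega> \<Longrightarrow> (u has_derivative (\<lambda>h. g x \<bullet> h)) (at x)"
    and cont: "continuous_on \<Omega> g"
  shows "C1_on \<Omega> u"
  unfolding C1_on_def
proof (intro conjI ballI allI)
  fix x assume "x \<in> \<Omega>" then show "u differentiable (at x)"
    using der differentiable_def by blast
next
  fix i
  have "continuous_on \<Omega> (\<lambda>x. g x $ i)" using cont by (intro continuous_intros)
  moreover have "partial_deriv i u x = g x $ i" if "x \<in> \<Omega>" for x
    using grad_eqI[OF der[OF that]] by (metis grad_nth)
  ultimately show "continuous_on \<Omega> (partial_deriv i u)"
    using continuous_on_cong[of \<Omega> \<Omega> "partial_deriv i u" "\<lambda>x. g x $ i"] by simp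
qed

lemma has_derivative_mult_grad:
  assumes "u differentiable (at x)" "v differentiable (at x)"
  shows "((\<lambda>x. u x * v x) has_derivative (\<lambda>h. (u x *\<^sub>R grad v x + v x *\<^sub>R grad u x) \<bullet> h)) (at x)"
  using has_derivative_mult[OF has_derivative_grad[OF assms(1)] has_derivative_grad[OF assms(2)]]
  by (simp add: algebra_simps)

lemma C1_on_continuous_on:
  assumes "C1_on \<Omega> u" shows "continuous_on \<Omega> u"
  using assms unfolding C1_on_def
  by (meson continuous_at_imp_continuous_on differentiable_imp_continuous_within)

lemma C1_on_mult:
  assumes "C1_on \<Omega> u" "C1_on \<Omega> v"
  shows "C1_on \<Omega> (\<lambda>x. u x * v x)"
proof (rule C1_onI)
  show "continuous_on \<Omega> (\<lambda>x. u x *\<^sub>R grad v x + v x *\<^sub>R grad u x)"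
    by (intro continuous_intros C1_on_continuous_on continuous_on_grad assms)
  fix x assume "x \<in> \<Omega>"
  then show "((\<lambda>x. u x * v x) has_derivative (\<lambda>h. (u x *\<^sub>R grad v x + v x *\<^sub>R grad u x) \<bullet> h)) (at x)"
    using assms by (intro has_derivative_mult_grad) (auto simp: C1_on_def)
qed

lemma grad_mult:
  assumes "u differentiable (at x)" "v differentiable (at x)"
  shows "grad (\<lambda>x. u x * v x) x = u x *\<^sub>R grad v x + v x *\<^sub>R grad u x"
  by (rule grad_eqI, rule has_derivative_mult_grad[OF assms])

lemma has_derivative_power_grad:
  assumes "u differentiable (at x)"
  shows "((\<lambda>x. u x ^ n) has_derivative (\<lambda>h. ((real n * u x ^ (n - 1)) *\<^sub>R grad u x) \<bullet> h)) (at x)"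
  using has_derivative_power[OF has_derivative_grad[OF assms], of n]
  by (simp add: algebra_simps)

lemma C1_on_power:
  assumes "C1_on \<Omega> u"
  shows "C1_on \<Omega> (\<lambda>x. u x ^ n)"
proof (rule C1_onI)
  show "continuous_on \<Omega> (\<lambda>x. (real n * u x ^ (n - 1)) *\<^sub>R grad u x)"
    by (intro continuous_intros C1_on_continuous_on continuous_on_grad assms)
  fix x assume "x \<in> \<Omega>"
  then show "((\<lambda>x. u x ^ n) has_derivative (\<lambda>h. ((real n * u x ^ (n - 1)) *\<^sub>R grad u x) \<bullet> h)) (at x)"
    using assms by (intro has_derivative_power_grad) (auto simp: C1_on_def)
qed

lemma grad_power:
  assumes "u differentiable (at x)"
  shows "grad (\<lambda>x. u x ^ n) x = (real n * u x ^ (n - 1)) *\<^sub>R grad u x"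
  by (rule grad_eqI, rule has_derivative_power_grad[OF assms])

lemma grad_zero_outside:
  assumes "closed S" "x \<notin> S" "\<And>x. x \<notin> S \<Longrightarrow> g x = 0"
  shows "(g has_derivative (\<lambda>h. 0)) (at x)" "grad g x = 0"
proof -
  show "(g has_derivative (\<lambda>h. 0)) (at x)"
  proof (rule has_derivative_transform_within_open)
    show "((\<lambda>x. 0) has_derivative (\<lambda>h. 0)) (at x)" by simp
    show "open (- S)" using assms(1) by blast
    show "x \<in> - S" using assms(2) by blast
    show "0 = g y" if "y \<in> - S" for y using assms(3)[of y] that by simp
  qed
  from grad_eqI[of g 0 x] this show "grad g x = 0" by simp
qed

lemma continuous_on_UNIV_zero_outside:
  fixes g :: "'a::topological_space \<Rightarrow> 'b::{topological_space,zero}"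
  assumes "open \<Omega>" "closed S" "S \<subseteq> \<Omega>" "continuous_on \<Omega> g" "\<And>x. x \<notin> S \<Longrightarrow> g x = 0"
  shows "continuous_on UNIV g"
proof -
  have "continuous_on (- S) g"
    using assms(5) continuous_on_cong[of "- S" "- S" g "\<lambda>_. 0"] by auto
  then have "continuous_on (\<Omega> \<union> - S) g"
    using assms by (intro continuous_on_open_Un) auto
  moreover have "\<Omega> \<union> - S = UNIV" using assms(3) by auto
  ultimately show ?thesis by simp
qed

lemma integrable_continuous_compact_support:
  fixes g :: "'a::euclidean_space \<Rightarrow> real"
  assumes "open \<Omega>" "compact S" "S \<subseteq> \<Omega>" "continuous_on \<Omega> g" "\<And>x. x \<notin> S \<Longrightarrow> g x = 0"
  shows "integrable lborel g"
proof -
  have "integrable lborel (\<lambda>x. indicator S x *\<^sub>R g x)"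
    using assms by (intro borel_integrable_compact) (auto intro: continuous_on_subset)
  also have "(\<lambda>x. indicator S x *\<^sub>R g x) = g" using assms(5) by (force simp: indicator_def fun_eq_iff)
  finally show ?thesis .
qed

section \<open>Integration by parts\<close>

lemma integral_translation_lborel:
  fixes f :: "'a::euclidean_space \<Rightarrow> real"
  assumes "f \<in> borel_measurable borel"
  shows "(\<integral>x. f (c + x) \<partial>lborel) = (\<integral>x. f x \<partial>lborel)"
    "integrable lborel f \<Longrightarrow> integrable lborel (\<lambda>x. f (c + x))"
proof -
  have m: "(+) c \<in> measurable lborel borel" by simp
  show "(\<integral>x. f (c + x) \<partial>lborel) = (\<integral>x. f x \<partial>lborel)"
    using integral_distr[OF m assms] by (simp add: lborel_distr_plus)
  show "integrable lborel f \<Longrightarrow> integrable lborel (\<lambda>x. f (c + x))"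
    using integrable_distr[OF m, of f] by (simp add: lborel_distr_plus)
qed

text \<open>
  The integral of every difference quotient vanishes by translation invariance, and the difference
  quotients are dominated, by the mean value theorem, by a constant on a fixed ball.\<close>
lemma integral_partial_deriv_eq_0:
  fixes g :: "real^'n::finite \<Rightarrow> real"
  assumes C1: "C1_on UNIV g" and S: "compact S" and zero: "\<And>x. x \<notin> S \<Longrightarrow> g x = 0"
  shows "(\<integral>x. partial_deriv i g x \<partial>lborel) = 0"
proof -
  define e :: "real^'n" where "e = axis i 1"
  \<comment> \<open>Steps of size at most 1 keep the supports of all difference quotients in one ball.\<close>
  define h :: "nat \<Rightarrow> real" where "h k = inverse (real (Suc k))" for k
  define D where "D k x = (g (h k *\<^sub>R e + x) - g x) / h k" for k x
  have h: "0 < h k" "h k \<le> 1" for k by (auto simp: h_def field_simps)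
  have ne: "norm e = 1" by (simp add: e_def)
  have pd: "partial_deriv i g x = grad g x \<bullet> e" for x by (simp add: e_def inner_axis)
  have gd: "(g has_derivative (\<lambda>v. grad g x \<bullet> v)) (at x)" for x
    using C1 by (intro has_derivative_grad) (auto simp: C1_on_def)
  have line: "((\<lambda>t. g (t *\<^sub>R e + x)) has_real_derivative partial_deriv i g (t *\<^sub>R e + x)) (at t)" for t x
  proof -
    have "((\<lambda>t. t *\<^sub>R e + x) has_derivative (\<lambda>s. s *\<^sub>R e)) (at t)"
      by (auto intro!: derivative_eq_intros)
    from has_derivative_compose[OF this gd]
    show ?thesis by (simp add: has_field_derivative_def pd mult.commute[of _ "grad _ _ \<bullet> e"])
  qed
  have cont: "continuous_on UNIV (partial_deriv i g)" using C1 by (simp add: C1_on_def)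
  have gc: "continuous_on UNIV g" using C1 by (rule C1_on_continuous_on)
  have meas [measurable]: "g \<in> borel_measurable borel" "partial_deriv i g \<in> borel_measurable borel"
    using cont gc by (auto intro: borel_measurable_continuous_onI)
  have pz: "partial_deriv i g x = 0" if "x \<notin> S" for x
    using grad_zero_outside(2)[OF compact_imp_closed[OF S] that zero] by (simp add: pd)
  have "bounded (partial_deriv i g ` S)"
    using S cont by (intro compact_imp_bounded compact_continuous_image) (auto intro: continuous_on_subset)
  then obtain M0 where "\<And>x. x \<in> S \<Longrightarrow> \<bar>partial_deriv i g x\<bar> \<le> M0"
    by (auto simp: bounded_iff)
  then have M: "\<bar>partial_deriv i g x\<bar> \<le> \<bar>M0\<bar>" for x
    using pz[of x] by (cases "x \<in> S") force+
  obtain r where r: "\<And>x. x \<in> S \<Longrightarrow> norm x \<le> r"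
    using compact_imp_bounded[OF S] by (auto simp: bounded_iff)
  have ig: "integrable lborel g"
    by (rule integrable_continuous_compact_support[of UNIV S]) (use S gc zero in auto)
  have D0: "(\<integral>x. D k x \<partial>lborel) = 0" for k
  proof -
    have "(\<integral>x. g (h k *\<^sub>R e + x) - g x \<partial>lborel) = 0"
      using integral_translation_lborel[of g "h k *\<^sub>R e"] ig by simp
    then show ?thesis unfolding D_def by simp
  qed
  have bound: "\<bar>D k x\<bar> \<le> \<bar>M0\<bar> * indicator (cball 0 (r + 1)) x" for k x
  proof (cases "x \<in> cball 0 (r + 1)")
    case True
    obtain t where "g (h k *\<^sub>R e + x) - g (0 *\<^sub>R e + x) = (h k - 0) * partial_deriv i g (t *\<^sub>R e + x)"
      using MVT2[of 0 "h k" "\<lambda>t. g (t *\<^sub>R e + x)" "\<lambda>t. partial_deriv i g (t *\<^sub>R e + x)"] line h(1)[of k]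
      by blast
    then have "D k x = partial_deriv i g (t *\<^sub>R e + x)"
      using h(1)[of k] by (simp add: D_def)
    then show ?thesis using M True by simp
  next
    case False
    then have "norm x > r + 1" by simp
    moreover have "norm x \<le> norm (h k *\<^sub>R e + x) + norm (h k *\<^sub>R e)"
      using norm_triangle_ineq4[of "h k *\<^sub>R e + x" "h k *\<^sub>R e"] by simp
    ultimately have "norm (h k *\<^sub>R e + x) > r" using h[of k] ne by simp
    then have "g (h k *\<^sub>R e + x) = 0" "g x = 0"
      using zero r \<open>norm x > r + 1\<close> by force+
    then show ?thesis using False by (simp add: D_def)
  qed
  have lim: "(\<lambda>k. D k x) \<longlonglongrightarrow> partial_deriv i g x" for x
  proof -
    have "((\<lambda>s. (g (s *\<^sub>R e + x) - g x) / s) \<longlongrightarrow> partial_deriv i g x) (at 0)"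
      using line[where t = 0 and x = x] by (simp add: DERIV_def)
    moreover have "filterlim h (at 0) sequentially"
      unfolding filterlim_at
    proof
      show "h \<longlonglongrightarrow> 0" unfolding h_def by (rule LIMSEQ_inverse_real_of_nat)
      show "\<forall>\<^sub>F x in sequentially. h x \<in> UNIV \<and> h x \<noteq> 0"
        using h(1) by (auto simp: less_imp_neq[symmetric])
    qed
    ultimately show ?thesis unfolding D_def by (rule filterlim_compose)
  qed
  have "(\<lambda>k. \<integral>x. D k x \<partial>lborel) \<longlonglongrightarrow> (\<integral>x. partial_deriv i g x \<partial>lborel)"
  proof (rule integral_dominated_convergence)
    have "integrable lborel (indicat_real (cball 0 (r + 1) :: (real^'n) set))"
      using emeasure_lborel_cball_finite by (intro integrable_real_indicator) auto
    then show "integrable lborel (\<lambda>x::real^'n. \<bar>M0\<bar> * indicator (cball 0 (r + 1)) x)"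
      by (rule integrable_mult_right)
    show "(\<lambda>x. D k x) \<in> borel_measurable lborel" for k unfolding D_def by measurable
    show "partial_deriv i g \<in> borel_measurable lborel" using meas by simp
    show "AE x in lborel. (\<lambda>k. D k x) \<longlonglongrightarrow> partial_deriv i g x" using lim by blast
    show "AE x in lborel. norm (D k x) \<le> \<bar>M0\<bar> * indicator (cball 0 (r + 1)) x" for k
      using bound[of k] by (simp only: real_norm_def) blast
  qed
  then show ?thesis by (simp add: D0 LIMSEQ_const_iff)
qed

lemma C1_on_UNIV_zero_outside:
  fixes g :: "real^'n::finite \<Rightarrow> real"
  assumes \<Omega>: "open \<Omega>" and S: "closed S" "S \<subseteq> \<Omega>"
    and C1: "C1_on \<Omega> g" and zero: "\<And>x. x \<notin> S \<Longrightarrow> g x = 0"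
  shows "C1_on UNIV g"
proof (rule C1_onI)
  show "(g has_derivative (\<lambda>h. grad g x \<bullet> h)) (at x)" for x
  proof (cases "x \<in> S")
    case True
    then show ?thesis using C1 S by (intro has_derivative_grad) (auto simp: C1_on_def)
  next
    case False
    then show ?thesis using grad_zero_outside[OF S(1) False zero] by simp
  qed
  show "continuous_on UNIV (grad g)"
    using \<Omega> S continuous_on_grad[OF C1] grad_zero_outside(2)[OF S(1) _ zero]
    by (rule continuous_on_UNIV_zero_outside)
qed

text \<open>
  The fields \<open>\<psi> \<partial>\<^sub>i u\<close> vanish off \<open>S\<close> and are therefore C1 on the whole space, although \<open>u\<close> is
  controlled on \<open>\<Omega>\<close> alone; their divergence has integral zero.\<close>
lemma integral_by_parts_laplacian:
  fixes u \<psi> :: "real^'n::finite \<Rightarrow> real"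
  assumes \<Omega>: "open \<Omega>" and S: "compact S" "S \<subseteq> \<Omega>"
    and u: "C2_on \<Omega> u" and \<psi>: "C1_on UNIV \<psi>" and zero: "\<And>x. x \<notin> S \<Longrightarrow> \<psi> x = 0"
  shows "integrable lborel (\<lambda>x. \<psi> x * laplacian u x)"
    and "integrable lborel (\<lambda>x. grad \<psi> x \<bullet> grad u x)"
    and "(\<integral>x. \<psi> x * - laplacian u x \<partial>lborel) = (\<integral>x. grad \<psi> x \<bullet> grad u x \<partial>lborel)"
proof -
  have cS: "closed S" using S(1) by (rule compact_imp_closed)
  have u1: "C1_on \<Omega> u" and u2: "C1_on \<Omega> (partial_deriv i u)" for i
    using u by (auto simp: C2_on_def)
  have \<psi>\<Omega>: "C1_on \<Omega> \<psi>" using \<psi> by (auto simp: C1_on_def intro: continuous_on_subset)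
  have gz: "grad \<psi> x = 0" if "x \<notin> S" for x
    using grad_zero_outside(2)[OF cS that zero] .
  then have pz: "partial_deriv i \<psi> x = 0" if "x \<notin> S" for x i
    using that by (metis grad_nth zero_index)
  have int1: "integrable lborel (\<lambda>x. \<psi> x * partial_deriv i (partial_deriv i u) x)" for i
    using u2[of i] zero
    by (intro integrable_continuous_compact_support[OF \<Omega> S] continuous_intros
        C1_on_continuous_on[OF \<psi>\<Omega>]) (auto simp: C1_on_def)
  have int2: "integrable lborel (\<lambda>x. partial_deriv i \<psi> x * partial_deriv i u x)" for i
    using u1 \<psi>\<Omega> pz
    by (intro integrable_continuous_compact_support[OF \<Omega> S] continuous_intros) (auto simp: C1_on_def)
  have key: "(\<integral>x. \<psi> x * partial_deriv i (partial_deriv i u) x \<partial>lborel)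
      = - (\<integral>x. partial_deriv i \<psi> x * partial_deriv i u x \<partial>lborel)" for i
  proof -
    define g where "g = (\<lambda>x. \<psi> x * partial_deriv i u x)"
    have g0: "g x = 0" if "x \<notin> S" for x using zero[OF that] by (simp add: g_def)
    have "C1_on UNIV g"
      using \<Omega> cS S(2) C1_on_mult[OF \<psi>\<Omega> u2[of i], folded g_def] g0
      by (rule C1_on_UNIV_zero_outside)
    then have "(\<integral>x. partial_deriv i g x \<partial>lborel) = 0"
      using S(1) g0 by (rule integral_partial_deriv_eq_0)
    moreover have "partial_deriv i g x = \<psi> x * partial_deriv i (partial_deriv i u) x
        + partial_deriv i \<psi> x * partial_deriv i u x" for x
    proof (cases "x \<in> S")
      case True
      then have "grad g x = \<psi> x *\<^sub>R grad (partial_deriv i u) x + partial_deriv i u x *\<^sub>R grad \<psi> x"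
        unfolding g_def using S(2) u2[of i] \<psi> by (intro grad_mult) (auto simp: C1_on_def)
      then have "grad g x $ i = (\<psi> x *\<^sub>R grad (partial_deriv i u) x + partial_deriv i u x *\<^sub>R grad \<psi> x) $ i"
        by simp
      then show ?thesis by (simp add: mult.commute)
    next
      case False
      then have "grad g x = 0" by (rule grad_zero_outside(2)[OF cS _ g0])
      then have "partial_deriv i g x = 0" by (metis grad_nth zero_index)
      then show ?thesis using zero[OF False] pz[OF False] by simp
    qed
    ultimately show ?thesis using int1[of i] int2[of i] by simp
  qed
  have lap: "\<psi> x * laplacian u x = (\<Sum>i\<in>UNIV. \<psi> x * partial_deriv i (partial_deriv i u) x)" for x
    by (simp add: laplacian_def sum_distrib_left)
  have inn: "grad \<psi> x \<bullet> grad u x = (\<Sum>i\<in>UNIV. partial_deriv i \<psi> x * partial_deriv i u x)" for x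
    by (simp add: inner_vec_def)
  show "integrable lborel (\<lambda>x. \<psi> x * laplacian u x)"
    unfolding lap by (intro Bochner_Integration.integrable_sum int1)
  show "integrable lborel (\<lambda>x. grad \<psi> x \<bullet> grad u x)"
    unfolding inn by (intro Bochner_Integration.integrable_sum int2)
  have "(\<integral>x. \<psi> x * - laplacian u x \<partial>lborel) = - (\<integral>x. \<psi> x * laplacian u x \<partial>lborel)"
    by simp
  also have "\<dots> = (\<integral>x. grad \<psi> x \<bullet> grad u x \<partial>lborel)"
    unfolding lap inn by (simp add: int1 int2 key sum_negf)
  finally show "(\<integral>x. \<psi> x * - laplacian u x \<partial>lborel) = (\<integral>x. grad \<psi> x \<bullet> grad u x \<partial>lborel)" .
qed

section \<open>Energy estimates with a cutoff\<close>

lemma cutoff_power_integrable: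
  fixes \<phi> f :: "real^'n::finite \<Rightarrow> real"
  assumes "open \<Omega>" "compact S" "S \<subseteq> \<Omega>" "C1_on UNIV \<phi>" "\<And>x. x \<notin> S \<Longrightarrow> \<phi> x = 0"
    "continuous_on \<Omega> f" "0 < m"
  shows "integrable lborel (\<lambda>x. f x * \<phi> x ^ m)"
  using assms(5,7)
  by (intro integrable_continuous_compact_support[OF assms(1-3)] continuous_intros assms(6)
      continuous_on_subset[OF C1_on_continuous_on[OF assms(4)]]) (auto simp: power_0_left)

text \<open>
  The power \<open>m \<ge> 2\<close> leaves the factor \<open>\<phi>^(m - 1)\<close> next to the gradient of the cutoff, so that
  the right-hand side is again supported in \<open>S\<close>.\<close>
lemma cutoff_test_inequality:
  fixes u f \<phi> :: "real^'n::finite \<Rightarrow> real"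
  assumes \<Omega>: "open \<Omega>" and S: "compact S" "S \<subseteq> \<Omega>"
    and u: "C2_on \<Omega> u" and f: "continuous_on \<Omega> f" and super: "\<And>x. x \<in> \<Omega> \<Longrightarrow> f x \<le> - laplacian u x"
    and \<phi>: "C1_on UNIV \<phi>" "\<And>x. 0 \<le> \<phi> x" "\<And>x. x \<notin> S \<Longrightarrow> \<phi> x = 0"
    and L: "\<And>x. x \<in> S \<Longrightarrow> norm (grad \<phi> x) \<le> L" and m: "2 \<le> m"
  shows "(\<integral>x. f x * \<phi> x ^ m \<partial>lborel) \<le> real m * L * (\<integral>x. norm (grad u x) * \<phi> x ^ (m - 1) \<partial>lborel)"
proof -
  have z: "\<phi> x ^ m = 0" if "x \<notin> S" for x using \<phi>(3)[OF that] m by simp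
  note parts = integral_by_parts_laplacian[OF \<Omega> S u C1_on_power[OF \<phi>(1)] z]
  have gu: "continuous_on \<Omega> (\<lambda>x. norm (grad u x))"
    using u by (intro continuous_intros continuous_on_grad) (auto simp: C2_on_def)
  have gi: "integrable lborel (\<lambda>x. norm (grad u x) * \<phi> x ^ (m - 1))"
    using \<phi>(3) gu m by (intro cutoff_power_integrable[OF \<Omega> S \<phi>(1)]) auto
  have "(\<integral>x. f x * \<phi> x ^ m \<partial>lborel) \<le> (\<integral>x. \<phi> x ^ m * - laplacian u x \<partial>lborel)"
  proof (rule integral_mono)
    show "integrable lborel (\<lambda>x. f x * \<phi> x ^ m)"
      using \<phi>(3) f m by (intro cutoff_power_integrable[OF \<Omega> S \<phi>(1)]) auto
    show "integrable lborel (\<lambda>x. \<phi> x ^ m * - laplacian u x)"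
      using parts(1) by simp
    show "f x * \<phi> x ^ m \<le> \<phi> x ^ m * - laplacian u x" for x
    proof (cases "x \<in> S")
      case True
      then have "f x \<le> - laplacian u x" using super S(2) by blast
      then have "\<phi> x ^ m * f x \<le> \<phi> x ^ m * - laplacian u x"
        using \<phi>(2) by (intro mult_left_mono) auto
      then show ?thesis by (simp add: mult.commute)
    qed (simp add: z)
  qed
  also have "\<dots> = (\<integral>x. grad (\<lambda>x. \<phi> x ^ m) x \<bullet> grad u x \<partial>lborel)"
    by (rule parts(3))
  also have "\<dots> \<le> (\<integral>x. real m * L * (norm (grad u x) * \<phi> x ^ (m - 1)) \<partial>lborel)"
  proof (rule integral_mono)
    show "integrable lborel (\<lambda>x. grad (\<lambda>x. \<phi> x ^ m) x \<bullet> grad u x)" by (rule parts(2))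
    show "integrable lborel (\<lambda>x. real m * L * (norm (grad u x) * \<phi> x ^ (m - 1)))"
      using gi by simp
    fix x
    have "grad (\<lambda>x. \<phi> x ^ m) x \<bullet> grad u x = real m * \<phi> x ^ (m - 1) * (grad \<phi> x \<bullet> grad u x)"
      using \<phi>(1) by (subst grad_power) (auto simp: C1_on_def)
    also have "\<dots> \<le> real m * L * (norm (grad u x) * \<phi> x ^ (m - 1))"
    proof (cases "x \<in> S")
      case True
      have "grad \<phi> x \<bullet> grad u x \<le> L * norm (grad u x)"
        using norm_cauchy_schwarz[of "grad \<phi> x" "grad u x"] mult_right_mono[OF L[OF True] norm_ge_zero[of "grad u x"]]
        by linarith
      then have "(real m * \<phi> x ^ (m - 1)) * (grad \<phi> x \<bullet> grad u x) \<le> (real m * \<phi> x ^ (m - 1)) * (L * norm (grad u x))"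
        using \<phi>(2) by (intro mult_left_mono) auto
      then show ?thesis by (simp add: algebra_simps)
    next
      case False
      then have "\<phi> x ^ (m - 1) = 0" using \<phi>(3) m by simp
      then show ?thesis by (simp only: mult_zero_left mult_zero_right order.refl)
    qed
    finally show "grad (\<lambda>x. \<phi> x ^ m) x \<bullet> grad u x \<le> real m * L * (norm (grad u x) * \<phi> x ^ (m - 1))" .
  qed
  also have "\<dots> = real m * L * (\<integral>x. norm (grad u x) * \<phi> x ^ (m - 1) \<partial>lborel)"
    by simp
  finally show ?thesis .
qed

text \<open>
  Either \<open>t \<le> a\<close>, or \<open>t = t^r t^(1 - r) \<le> t^r a^(1 - r)\<close>. This replaces the inequalities of Hoelder
  and Young and covers \<open>r = 1\<close> without a separate case.\<close>
lemma le_threshold_plus_powr: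
  fixes t a r :: real
  assumes "0 \<le> t" "0 < a" "1 \<le> r"
  shows "t \<le> a + a powr (1 - r) * t powr r"
proof (cases "t \<le> a")
  case True
  then show ?thesis by (simp add: add_increasing2)
next
  case False
  then have t: "0 < t" using assms by simp
  have "a powr (r - 1) \<le> t powr (r - 1)"
    using assms False by (intro powr_mono2) auto
  then have "t * 1 \<le> t * (a powr (1 - r) * t powr (r - 1))"
    using t assms by (intro mult_left_mono) (auto simp: powr_diff field_simps)
  also have "\<dots> = a powr (1 - r) * t powr r"
    using t by (simp add: powr_diff)
  finally show ?thesis using assms by simp
qed

text \<open>
  The scalar inequality is applied to \<open>t = g \<phi>^m\<close>. Raising to the power \<open>r\<close> multiplies the exponent
  of the cutoff by \<open>r\<close>; as \<open>\<phi> \<le> 1\<close>, it may then be lowered to any \<open>k \<le> r m\<close>.\<close>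
lemma cutoff_threshold_inequality:
  fixes g \<phi> :: "real^'n::finite \<Rightarrow> real"
  assumes \<Omega>: "open \<Omega>" and S: "compact S" "S \<subseteq> \<Omega>"
    and g: "continuous_on \<Omega> g" "\<And>x. 0 \<le> g x"
    and \<phi>: "C1_on UNIV \<phi>" "\<And>x. 0 \<le> \<phi> x" "\<And>x. \<phi> x \<le> 1" "\<And>x. x \<notin> S \<Longrightarrow> \<phi> x = 0"
    and m: "0 < m" "0 < k" and mk: "real k \<le> r * real m" and r: "1 \<le> r" and a: "0 < a"
  shows "(\<integral>x. g x * \<phi> x ^ m \<partial>lborel)
      \<le> a * measure lborel S + a powr (1 - r) * (\<integral>x. g x powr r * \<phi> x ^ k \<partial>lborel)"
proof -
  have gr: "continuous_on \<Omega> (\<lambda>x. g x powr r)"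
    using g r by (intro continuous_on_powr') auto
  have i1: "integrable lborel (\<lambda>x. g x powr r * \<phi> x ^ k)"
    using \<phi>(4) gr m by (intro cutoff_power_integrable[OF \<Omega> S \<phi>(1)]) auto
  have i2: "integrable lborel (\<lambda>x. a * indicat_real S x)"
    using S(1) emeasure_bounded_finite[OF compact_imp_bounded[OF S(1)]] borel_closed[OF compact_imp_closed[OF S(1)]]
    by (intro integrable_mult_right integrable_real_indicator) auto
  have "(\<integral>x. g x * \<phi> x ^ m \<partial>lborel)
      \<le> (\<integral>x. a * indicat_real S x + a powr (1 - r) * (g x powr r * \<phi> x ^ k) \<partial>lborel)"
  proof (rule integral_mono)
    show "integrable lborel (\<lambda>x. g x * \<phi> x ^ m)"
      using \<phi>(4) g m by (intro cutoff_power_integrable[OF \<Omega> S \<phi>(1)]) auto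
    show "integrable lborel (\<lambda>x. a * indicat_real S x + a powr (1 - r) * (g x powr r * \<phi> x ^ k))"
      using i1 i2 by simp
    fix x
    show "g x * \<phi> x ^ m \<le> a * indicat_real S x + a powr (1 - r) * (g x powr r * \<phi> x ^ k)"
    proof (cases "x \<in> S \<and> \<phi> x \<noteq> 0")
      case False
      then show ?thesis using \<phi>(4)[of x] m a by (cases "x \<in> S") (auto simp: zero_power)
    next
      case True
      then have pos: "0 < \<phi> x" using \<phi>(2)[of x] by simp
      have "(g x * \<phi> x ^ m) powr r = g x powr r * \<phi> x powr (r * real m)"
        using pos g(2)[of x] by (simp add: powr_mult powr_powr powr_realpow[symmetric] mult.commute)
      also have "\<dots> \<le> g x powr r * \<phi> x powr (real k)"
        using pos \<phi>(3)[of x] mk by (intro mult_left_mono powr_mono') auto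
      also have "\<dots> = g x powr r * \<phi> x ^ k"
        using pos by (simp add: powr_realpow)
      finally have "a powr (1 - r) * (g x * \<phi> x ^ m) powr r \<le> a powr (1 - r) * (g x powr r * \<phi> x ^ k)"
        by (intro mult_left_mono) auto
      moreover have "g x * \<phi> x ^ m \<le> a + a powr (1 - r) * (g x * \<phi> x ^ m) powr r"
        using g(2)[of x] \<phi>(2)[of x] a r by (intro le_threshold_plus_powr) auto
      ultimately show ?thesis using True by simp
    qed
  qed
  also have "\<dots> = a * measure lborel S + a powr (1 - r) * (\<integral>x. g x powr r * \<phi> x ^ k \<partial>lborel)"
    using i1 i2 S(1) by simp
  finally show ?thesis .
qed

text \<open>
  Each integration by parts costs one power of the cutoff. Starting from \<open>\<phi>^(m + 2)\<close> in the first
  energy, the second one naturally carries \<open>\<phi>^(m + 1)\<close>, and there remains \<open>\<phi>^m\<close> on the way back. The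
  superlinear power \<open>p\<close> then restores the exponent to \<open>m + 2\<close>, if \<open>m + 2 \<le> p m\<close>.\<close>
lemma supersolution_energy_inequalities:
  fixes u1 u2 \<phi> :: "real^'n::finite \<Rightarrow> real"
  assumes pq: "1 \<le> q" "1 \<le> p" and super: "supersolution p q \<Omega> u1 u2"
    and \<Omega>: "open \<Omega>" and S: "compact S" "S \<subseteq> \<Omega>"
    and \<phi>: "C1_on UNIV \<phi>" "\<And>x. 0 \<le> \<phi> x" "\<And>x. \<phi> x \<le> 1" "\<And>x. x \<notin> S \<Longrightarrow> \<phi> x = 0"
    and L: "\<And>x. x \<in> S \<Longrightarrow> norm (grad \<phi> x) \<le> L" "0 \<le> L"
    and m: "1 \<le> m" "real m + 2 \<le> p * real m"
    and a: "0 < a" and b: "0 < b"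
  defines "X \<equiv> \<integral>x. norm (grad u2 x) powr p * \<phi> x ^ (m + 2) \<partial>lborel"
    and "Y \<equiv> \<integral>x. norm (grad u1 x) powr q * \<phi> x ^ (m + 1) \<partial>lborel"
  shows "X \<le> real (m + 2) * L * (a * measure lborel S + a powr (1 - q) * Y)"
    and "Y \<le> real (m + 2) * L * (b * measure lborel S + b powr (1 - p) * X)"
proof -
  have u: "C2_on \<Omega> u1" "C2_on \<Omega> u2"
    and ineq1: "\<And>x. x \<in> \<Omega> \<Longrightarrow> norm (grad u2 x) powr p \<le> - laplacian u1 x"
    and ineq2: "\<And>x. x \<in> \<Omega> \<Longrightarrow> norm (grad u1 x) powr q \<le> - laplacian u2 x"
    using super by (auto simp: supersolution_def)
  have gc: "continuous_on \<Omega> (\<lambda>x. norm (grad u1 x))" "continuous_on \<Omega> (\<lambda>x. norm (grad u2 x))"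
    using u by (auto intro!: continuous_on_norm continuous_on_grad simp: C2_on_def)
  have gp: "continuous_on \<Omega> (\<lambda>x. norm (grad u1 x) powr q)" "continuous_on \<Omega> (\<lambda>x. norm (grad u2 x) powr p)"
    using gc pq by (auto intro!: continuous_on_powr')
  have "X \<le> real (m + 2) * L * (\<integral>x. norm (grad u1 x) * \<phi> x ^ (m + 1) \<partial>lborel)"
    using cutoff_test_inequality[OF \<Omega> S u(1) gp(2) ineq1 \<phi>(1,2,4) L(1), where m = "m + 2"]
    by (simp add: X_def)
  also have "\<dots> \<le> real (m + 2) * L * (a * measure lborel S + a powr (1 - q) * Y)"
    unfolding Y_def using pq m L(2) a
    by (intro mult_left_mono cutoff_threshold_inequality[OF \<Omega> S gc(1) _ \<phi>]) (auto simp: mult_le_cancel_right1)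
  finally show "X \<le> real (m + 2) * L * (a * measure lborel S + a powr (1 - q) * Y)" .
  have "Y \<le> real (m + 1) * L * (\<integral>x. norm (grad u2 x) * \<phi> x ^ m \<partial>lborel)"
    using cutoff_test_inequality[OF \<Omega> S u(2) gp(1) ineq2 \<phi>(1,2,4) L(1), where m = "m + 1"] m
    by (simp add: Y_def)
  also have "\<dots> \<le> real (m + 2) * L * (\<integral>x. norm (grad u2 x) * \<phi> x ^ m \<partial>lborel)"
    using L(2) \<phi>(2) by (intro mult_right_mono integral_nonneg) auto
  also have "\<dots> \<le> real (m + 2) * L * (b * measure lborel S + b powr (1 - p) * X)"
    unfolding X_def using pq m L(2) b
    by (intro mult_left_mono cutoff_threshold_inequality[OF \<Omega> S gc(2) _ \<phi>]) auto
  finally show "Y \<le> real (m + 2) * L * (b * measure lborel S + b powr (1 - p) * X)" .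
qed

text \<open>
  The coefficient \<open>1 / (2 k^2)\<close> is what a suitable threshold provides; composing the two inequalities
  then returns only \<open>x / 2\<close>, which is absorbed on the left.\<close>
lemma absorb_coupled_inequalities:
  fixes x y k w \<beta> :: real
  assumes "0 < k" "x \<le> k * (w + y)" "y \<le> k * (\<beta> * w + x / (2 * k\<^sup>2))"
  shows "x \<le> 2 * (k + k\<^sup>2 * \<beta>) * w" "y \<le> (1 + 2 * k * \<beta>) * w"
proof -
  have y: "y \<le> k * \<beta> * w + x / (2 * k)"
  proof -
    have "k * (\<beta> * w + x / (2 * k\<^sup>2)) = k * \<beta> * w + x / (2 * k)"
      using assms(1) by (simp add: power2_eq_square field_simps)
    then show ?thesis using assms(3) by simp
  qed
  have "x \<le> k * w + k * (k * \<beta> * w + x / (2 * k))"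
    using assms(1,2) mult_left_mono[OF y, of k] by (simp add: algebra_simps)
  also have "\<dots> = (k + k\<^sup>2 * \<beta>) * w + x / 2"
    using assms(1) by (simp add: power2_eq_square field_simps)
  finally show x: "x \<le> 2 * (k + k\<^sup>2 * \<beta>) * w" by (simp only: mult.assoc)
  have "x / (2 * k) \<le> 2 * (k + k\<^sup>2 * \<beta>) * w / (2 * k)"
    using x assms(1) by (intro divide_right_mono) auto
  also have "\<dots> = (1 + k * \<beta>) * w"
    using assms(1) by (simp add: power2_eq_square field_simps)
  finally show "y \<le> (1 + 2 * k * \<beta>) * w"
    using y by (simp add: algebra_simps)
qed

section \<open>Radial cutoffs\<close>

definition sqpos :: "real \<Rightarrow> real" where "sqpos t = (max 0 t)\<^sup>2"

lemma sqpos_has_derivative: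
  "(sqpos has_real_derivative 2 * max 0 t) (at t)"
proof -
  consider "t < 0" | "t > 0" | "t = 0" by linarith
  then show ?thesis
  proof cases
    case 1
    show ?thesis
      by (rule has_field_derivative_transform_within_open[of "\<lambda>_. 0" _ _ "{..<0}"])
        (use 1 in \<open>auto simp: sqpos_def\<close>)
  next
    case 2
    have "((\<lambda>t::real. t\<^sup>2) has_real_derivative 2 * max 0 t) (at t)"
      using 2 by (auto intro!: derivative_eq_intros)
    then show ?thesis
      by (rule has_field_derivative_transform_within_open[of _ _ _ "{0<..}"])
        (use 2 in \<open>auto simp: sqpos_def\<close>)
  next
    case 3
    have "(\<lambda>h. (sqpos (0 + h) - sqpos 0) / h) = (\<lambda>h. max 0 h)"
      by (auto simp: fun_eq_iff sqpos_def max_def power2_eq_square)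
    moreover have "(max 0 \<longlongrightarrow> (0::real)) (at 0)"
      using tendsto_max[OF tendsto_const tendsto_ident_at, of "0::real" 0 UNIV] by (simp add: eta_contract_eq)
    ultimately show ?thesis using 3 by (simp add: DERIV_def)
  qed
qed

text \<open>
  A C1 transition from 0 to 1 that needs no case distinction at the two ends, as its pieces are glued
  by \<open>sqpos\<close>.\<close>
definition smooth_step :: "real \<Rightarrow> real" where "smooth_step t = 1 - sqpos (1 - sqpos t)"

lemma smooth_step_bounds: "0 \<le> smooth_step t" "smooth_step t \<le> 1"
proof -
  have "0 \<le> max 0 (1 - (max 0 t)\<^sup>2)" "max 0 (1 - (max 0 t)\<^sup>2) \<le> 1" by auto
  then show "0 \<le> smooth_step t" "smooth_step t \<le> 1"
    by (auto simp: smooth_step_def sqpos_def abs_square_le_1)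
qed

lemma smooth_step_eq_0: "t \<le> 0 \<Longrightarrow> smooth_step t = 0"
  by (simp add: smooth_step_def sqpos_def)

lemma smooth_step_eq_1: "1 \<le> t \<Longrightarrow> smooth_step t = 1"
  by (simp add: smooth_step_def sqpos_def)

lemma smooth_step_C1:
  obtains s' where "\<And>t. (smooth_step has_real_derivative s' t) (at t)" "continuous_on UNIV s'"
proof
  show "(smooth_step has_real_derivative 2 * max 0 (1 - sqpos t) * (2 * max 0 t)) (at t)" for t
    unfolding smooth_step_def[abs_def]
    by (auto intro!: derivative_eq_intros DERIV_chain2[OF sqpos_has_derivative] sqpos_has_derivative)
  show "continuous_on UNIV (\<lambda>t. 2 * max 0 (1 - sqpos t) * (2 * max 0 t))"
    unfolding sqpos_def by (intro continuous_intros)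
qed

text \<open>
  The profile is a function of \<open>|x|^2 / R^2\<close>. A negative \<open>a\<close> is allowed: with \<open>a < b = 0\<close> the
  corresponding radial cutoff is one on a ball, with \<open>0 < a < b\<close> it is one on an annulus.\<close>
lemma cutoff_profile_exists:
  fixes a b c d :: real
  assumes "a < b" "c < d"
  obtains F F' where
    "\<And>s. (F has_real_derivative F' s) (at s)" "continuous_on UNIV F'"
    "\<And>s. 0 \<le> F s" "\<And>s. F s \<le> 1" "\<And>s. F s \<noteq> 0 \<Longrightarrow> a \<le> s \<and> s \<le> d"
    "\<And>s. b \<le> s \<Longrightarrow> s \<le> c \<Longrightarrow> F s = 1"
proof -
  obtain s' where s': "\<And>t. (smooth_step has_real_derivative s' t) (at t)" "continuous_on UNIV s'"
    using smooth_step_C1 by blast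
  define l where "l s = (s - a) / (b - a)" for s
  define r where "r s = (d - s) / (d - c)" for s
  have comp: "continuous_on UNIV (\<lambda>s. s' (l s))" "continuous_on UNIV (\<lambda>s. s' (r s))"
    "continuous_on UNIV (\<lambda>s. smooth_step (l s))" "continuous_on UNIV (\<lambda>s. smooth_step (r s))"
  proof -
    have "continuous_on UNIV l" "continuous_on UNIV r"
      unfolding l_def r_def using assms by (auto intro!: continuous_intros)
    moreover have "continuous_on UNIV smooth_step"
      using s'(1) DERIV_continuous_on by blast
    ultimately show "continuous_on UNIV (\<lambda>s. s' (l s))" "continuous_on UNIV (\<lambda>s. s' (r s))"
      "continuous_on UNIV (\<lambda>s. smooth_step (l s))" "continuous_on UNIV (\<lambda>s. smooth_step (r s))"
      using s'(2) by (auto intro: continuous_on_compose2)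
  qed
  show thesis
  proof
    fix s
    have dl: "(l has_real_derivative 1 / (b - a)) (at s)" and dr: "(r has_real_derivative - 1 / (d - c)) (at s)"
      unfolding l_def[abs_def] r_def[abs_def]
      by (intro DERIV_cdivide; auto intro!: derivative_eq_intros)+
    show "((\<lambda>s. smooth_step (l s) * smooth_step (r s)) has_real_derivative
        (s' (l s) * (1 / (b - a)) * smooth_step (r s) + s' (r s) * (- 1 / (d - c)) * smooth_step (l s))) (at s)"
      by (rule DERIV_mult[OF DERIV_chain2[OF s'(1) dl] DERIV_chain2[OF s'(1) dr]])
    show "0 \<le> smooth_step (l s) * smooth_step (r s)" "smooth_step (l s) * smooth_step (r s) \<le> 1"
      using smooth_step_bounds[of "l s"] smooth_step_bounds[of "r s"] by (auto intro: mult_le_one)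
    show "a \<le> s \<and> s \<le> d" if "smooth_step (l s) * smooth_step (r s) \<noteq> 0"
    proof (rule ccontr)
      assume "\<not> (a \<le> s \<and> s \<le> d)"
      then have "l s \<le> 0 \<or> r s \<le> 0"
        unfolding l_def r_def using assms by (auto simp: field_simps)
      then show False using that smooth_step_eq_0 by auto
    qed
    show "smooth_step (l s) * smooth_step (r s) = 1" if "b \<le> s" "s \<le> c"
      using that assms by (subst (1 2) smooth_step_eq_1) (auto simp: l_def r_def field_simps)
  next
    show "continuous_on UNIV (\<lambda>s. s' (l s) * (1 / (b - a)) * smooth_step (r s) + s' (r s) * (- 1 / (d - c)) * smooth_step (l s))"
      by (intro continuous_intros comp)
  qed
qed

lemma radial_cutoff:
  fixes F F' :: "real \<Rightarrow> real"
  assumes F: "\<And>s. (F has_real_derivative F' s) (at s)" "continuous_on UNIV F'" and R: "0 < R"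
  defines "\<phi> \<equiv> \<lambda>x::real^'n::finite. F (x \<bullet> x / R\<^sup>2)"
  shows "C1_on UNIV \<phi>" "grad \<phi> x = (2 * F' (x \<bullet> x / R\<^sup>2) / R\<^sup>2) *\<^sub>R x"
proof -
  have der: "(\<phi> has_derivative (\<lambda>h. ((2 * F' (x \<bullet> x / R\<^sup>2) / R\<^sup>2) *\<^sub>R x) \<bullet> h)) (at x)" for x
  proof -
    have "((\<lambda>x. x \<bullet> x / R\<^sup>2) has_derivative (\<lambda>h. 2 * (x \<bullet> h) / R\<^sup>2)) (at x)"
    proof (rule bounded_linear.has_derivative[OF bounded_linear_divide])
      show "((\<lambda>x. x \<bullet> x) has_derivative (\<lambda>h. 2 * (x \<bullet> h))) (at x)"
        by (auto intro!: derivative_eq_intros simp: inner_commute)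
    qed
    from has_derivative_compose[OF this F(1)[unfolded has_field_derivative_def]]
    show ?thesis unfolding \<phi>_def by (simp add: mult_ac)
  qed
  have "continuous_on UNIV (\<lambda>x::real^'n. F' (x \<bullet> x / R\<^sup>2))"
    by (rule continuous_on_compose2[OF F(2)]) (use R in \<open>auto intro!: continuous_intros\<close>)
  then show "C1_on UNIV \<phi>"
    using der R by (intro C1_onI[where g = "\<lambda>x. (2 * F' (x \<bullet> x / R\<^sup>2) / R\<^sup>2) *\<^sub>R x"])
      (auto intro!: continuous_intros)
  show "grad \<phi> x = (2 * F' (x \<bullet> x / R\<^sup>2) / R\<^sup>2) *\<^sub>R x" using der by (rule grad_eqI)
qed

section \<open>The estimate on the scale of the cutoff\<close>

text \<open>
  The constant depends on the profile, hence on the four levels, but neither on \<open>R\<close> nor on the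
  functions. The levels refer to \<open>|x|^2 / R^2\<close>, so that annuli and balls are treated at once.\<close>
theorem rescaled_energy_estimate:
  fixes p q a b c d :: real
  assumes pq: "1 \<le> q" "1 < p" "1 < p * q" and radii: "a < b" "c < d" "0 < d"
  obtains C where "0 < C"
    "\<And>R \<Omega> (u1 :: real^'n::finite \<Rightarrow> real) u2. \<lbrakk>0 < R; open \<Omega>; supersolution p q \<Omega> u1 u2;
        {x. a * R\<^sup>2 \<le> x \<bullet> x \<and> x \<bullet> x \<le> d * R\<^sup>2} \<subseteq> \<Omega>\<rbrakk> \<Longrightarrow>
      (LINT x:{x. b * R\<^sup>2 \<le> x \<bullet> x \<and> x \<bullet> x \<le> c * R\<^sup>2}|lborel. norm (grad u2 x) powr p)
        \<le> C * R powr (real CARD('n) - p * (q + 1) / (p * q - 1)) \<and>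
      (LINT x:{x. b * R\<^sup>2 \<le> x \<bullet> x \<and> x \<bullet> x \<le> c * R\<^sup>2}|lborel. norm (grad u1 x) powr q)
        \<le> C * R powr (real CARD('n) - q * (p + 1) / (p * q - 1))"
proof -
  obtain F F' where F: "\<And>s. (F has_real_derivative F' s) (at s)" "continuous_on UNIV F'"
    and F_bounds: "\<And>s. 0 \<le> F s" "\<And>s. F s \<le> 1"
    and F_supp: "\<And>s. F s \<noteq> 0 \<Longrightarrow> a \<le> s \<and> s \<le> d"
    and F_one: "\<And>s. b \<le> s \<Longrightarrow> s \<le> c \<Longrightarrow> F s = 1"
    using cutoff_profile_exists[OF radii(1,2)] by blast
  have "bounded (F' ` {0..d})"
    using F(2) by (intro compact_imp_bounded compact_continuous_image) (auto intro: continuous_on_subset)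
  then obtain M where "\<forall>s\<in>{0..d}. \<bar>F' s\<bar> \<le> M"
    by (auto simp: bounded_iff)
  then have M: "\<bar>F' s\<bar> \<le> \<bar>M\<bar> + 1" if "0 \<le> s" "s \<le> d" for s using that by force
  \<comment> \<open>\<open>l / R\<close> bounds the gradient of the rescaled cutoff on its support.\<close>
  define l where "l = 2 * (\<bar>M\<bar> + 1) * sqrt d"
  have l: "0 < l" using radii(3) by (simp add: l_def)
  \<comment> \<open>\<open>m + 2 \<le> p m\<close> means \<open>m \<ge> 2 / (p - 1)\<close>.\<close>
  define m where "m = Suc (nat \<lceil>2 / (p - 1)\<rceil>)"
  have "2 / (p - 1) \<le> real m" unfolding m_def by linarith
  then have m: "1 \<le> m" "real m + 2 \<le> p * real m"
    using pq(2) by (simp add: m_def, simp add: field_simps)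
  define k where "k = real (m + 2) * l"
  have k: "0 < k" using l by (simp add: k_def)
  \<comment> \<open>The threshold that makes the feedback of the second inequality equal to \<open>1 / (2 k^2)\<close>.\<close>
  define \<beta> where "\<beta> = (2 * k\<^sup>2) powr (1 / (p - 1))"
  have \<beta>: "0 < \<beta>" "\<beta> powr (1 - p) = 1 / (2 * k\<^sup>2)"
  proof -
    show "0 < \<beta>" using k by (simp add: \<beta>_def)
    have "1 / (p - 1) * (1 - p) = - 1" using pq(2) by (simp add: field_simps)
    then have "\<beta> powr (1 - p) = (2 * k\<^sup>2) powr (- 1)" unfolding \<beta>_def powr_powr by simp
    also have "\<dots> = 1 / (2 * k\<^sup>2)" using k by (simp add: powr_minus_divide)
    finally show "\<beta> powr (1 - p) = 1 / (2 * k\<^sup>2)" .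
  qed
  define N where "N = real CARD('n)"
  define v where "v = unit_ball_vol N * sqrt d ^ CARD('n)"
  have v: "0 < v" using radii(3) by (simp add: v_def N_def)
  define C where "C = max (2 * (k + k\<^sup>2 * \<beta>) * v) ((1 + 2 * k * \<beta>) * v)"
  define s where "s = (p + 1) / (p * q - 1)"
  define t where "t = (q + 1) / (p * q - 1)"
  have st: "s + 1 = p * t" "t + 1 = q * s"
    using pq(3) by (simp_all add: s_def t_def field_simps)
  have exps: "p * (q + 1) / (p * q - 1) = p * t" "q * (p + 1) / (p * q - 1) = q * s"
    by (simp_all add: s_def t_def)
  show thesis
  proof (rule that)
    have "0 < (1 + 2 * k * \<beta>) * v" using k \<beta>(1) v by (simp add: add_pos_pos)
    then show "0 < C" by (simp add: C_def)
  next
    fix R :: real and \<Omega> :: "(real^'n) set" and u1 u2 :: "real^'n \<Rightarrow> real"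
    assume R: "0 < R" and \<Omega>: "open \<Omega>" and super: "supersolution p q \<Omega> u1 u2"
      and sub: "{x. a * R\<^sup>2 \<le> x \<bullet> x \<and> x \<bullet> x \<le> d * R\<^sup>2} \<subseteq> \<Omega>"
    define S where "S = {x::real^'n. a * R\<^sup>2 \<le> x \<bullet> x \<and> x \<bullet> x \<le> d * R\<^sup>2}"
    define A where "A = {x::real^'n. b * R\<^sup>2 \<le> x \<bullet> x \<and> x \<bullet> x \<le> c * R\<^sup>2}"
    define \<phi> where "\<phi> = (\<lambda>x::real^'n. F (x \<bullet> x / R\<^sup>2))"
    have norm_S: "norm x \<le> sqrt d * R" if "x \<in> S" for x
    proof -
      have "norm x = sqrt (x \<bullet> x)" by (rule norm_eq_sqrt_inner)
      also have "\<dots> \<le> sqrt (d * R\<^sup>2)" using that by (simp add: S_def)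
      finally show ?thesis using R by (simp add: real_sqrt_mult)
    qed
    have S_ball: "S \<subseteq> cball 0 (sqrt d * R)" using norm_S by auto
    have "closed S" unfolding S_def by (intro closed_Collect_conj closed_Collect_le continuous_intros)
    then have S: "compact S" "S \<subseteq> \<Omega>"
      using S_ball bounded_subset[OF bounded_cball] sub by (auto simp: compact_eq_bounded_closed S_def)
    have A_meas: "A \<in> sets borel"
      unfolding A_def by (intro borel_closed closed_Collect_conj closed_Collect_le continuous_intros)
    have \<phi>: "C1_on UNIV \<phi>" "\<And>x. 0 \<le> \<phi> x" "\<And>x. \<phi> x \<le> 1"
      using radial_cutoff(1)[OF F R] F_bounds by (auto simp: \<phi>_def)
    have \<phi>0: "\<phi> x = 0" if "x \<notin> S" for x
      using that F_supp[of "x \<bullet> x / R\<^sup>2"] R unfolding \<phi>_def S_def by (auto simp: field_simps)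
    have \<phi>1: "\<phi> x = 1" if "x \<in> A" for x
      using that R F_one[of "x \<bullet> x / R\<^sup>2"] by (simp add: A_def \<phi>_def field_simps)
    have grad_le: "norm (grad \<phi> x) \<le> l / R" if "x \<in> S" for x
    proof -
      have "x \<bullet> x / R\<^sup>2 \<le> d" using that R by (simp add: S_def field_simps)
      then have F'_le: "\<bar>F' (x \<bullet> x / R\<^sup>2)\<bar> \<le> \<bar>M\<bar> + 1" by (intro M) auto
      have "norm (grad \<phi> x) = 2 * \<bar>F' (x \<bullet> x / R\<^sup>2)\<bar> / R\<^sup>2 * norm x"
        using radial_cutoff(2)[OF F R, of x] by (simp add: \<phi>_def abs_mult)
      also have "\<dots> \<le> 2 * (\<bar>M\<bar> + 1) / R\<^sup>2 * (sqrt d * R)"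
        using norm_S[OF that] F'_le
        by (intro mult_mono divide_right_mono mult_left_mono) auto
      also have "\<dots> = l / R"
        using R by (simp add: l_def power2_eq_square)
      finally show ?thesis .
    qed
    have vol: "measure lborel S \<le> v * R powr N"
    proof -
      have "measure lborel S \<le> measure lborel (cball (0::real^'n) (sqrt d * R))"
        using S_ball S(1) emeasure_lborel_cball_finite[of "0::real^'n" "sqrt d * R"]
        by (intro measure_mono_fmeasurable) (auto simp: fmeasurable_def intro: borel_closed compact_imp_closed)
      also have "\<dots> = unit_ball_vol N * (sqrt d * R) ^ CARD('n)"
        using R radii(3) by (subst content_cball) (auto simp: N_def)
      also have "\<dots> = v * R powr N"
        using R by (simp add: v_def N_def power_mult_distrib powr_realpow)
      finally show ?thesis .
    qed
    define X where "X = (\<integral>x. norm (grad u2 x) powr p * \<phi> x ^ (m + 2) \<partial>lborel)"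
    define Y where "Y = (\<integral>x. norm (grad u1 x) powr q * \<phi> x ^ (m + 1) \<partial>lborel)"
    have a0: "0 < R powr (- s)" "0 < \<beta> * R powr (- t)" using R \<beta>(1) by auto
    have lR: "0 \<le> l / R" and kR: "0 \<le> real (m + 2) * (l / R)" using l R by simp_all
    note energy = supersolution_energy_inequalities[OF pq(1) less_imp_le[OF pq(2)] super \<Omega> S \<phi> \<phi>0
        grad_le lR m a0, folded X_def Y_def]
    \<comment> \<open>Multiplying by the natural powers of R makes both inequalities independent of R.\<close>
    define x where "x = X * R powr (p * t)"
    define y where "y = Y * R powr (q * s)"
    define w where "w = v * R powr N"
    have regroup: "real (m + 2) * (l / R) * (A * W + B * Z) * P = real (m + 2) * l * ((P / R * A) * W + (P / R * B) * Z)"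
      for A B P W Z :: real
      by (simp add: algebra_simps add_divide_distrib)
    have \<beta>_split: "(\<beta> * R powr (- t)) powr (1 - p) = \<beta> powr (1 - p) * (R powr (- t)) powr (1 - p)"
      using \<beta>(1) by (simp add: powr_mult)
    have powr_div: "R powr e / R * R powr f = R powr (e + f - 1)" for e f
      using R by (simp add: powr_add powr_diff)
    have pw: "R powr (p * t) / R * R powr (- s) = 1" "R powr (p * t) / R * R powr (- s * (1 - q)) = R powr (q * s)"
      "R powr (q * s) / R * R powr (- t) = 1" "R powr (q * s) / R * R powr (- t * (1 - p)) = R powr (p * t)"
    proof -
      \<comment> \<open>All four follow from \<open>s + 1 = p t\<close> and \<open>t + 1 = q s\<close>.\<close>
      have "p * t + - s - 1 = 0" "p * t + - s * (1 - q) - 1 = q * s"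
        "q * s + - t - 1 = 0" "q * s + - t * (1 - p) - 1 = p * t"
        using st by (simp_all add: algebra_simps)
      then show "R powr (p * t) / R * R powr (- s) = 1" "R powr (p * t) / R * R powr (- s * (1 - q)) = R powr (q * s)"
        "R powr (q * s) / R * R powr (- t) = 1" "R powr (q * s) / R * R powr (- t * (1 - p)) = R powr (p * t)"
        unfolding powr_div using R by simp_all
    qed
    have x_le: "x \<le> k * (w + y)"
    proof -
      have "x \<le> real (m + 2) * (l / R) * (R powr (- s) * measure lborel S + (R powr (- s)) powr (1 - q) * Y) * R powr (p * t)"
        unfolding x_def using energy(1) by (intro mult_right_mono) auto
      also have "\<dots> \<le> real (m + 2) * (l / R) * (R powr (- s) * w + (R powr (- s)) powr (1 - q) * Y) * R powr (p * t)"
        using vol kR unfolding w_def by (intro mult_right_mono mult_left_mono add_right_mono) simp_all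
      also have "\<dots> = k * ((R powr (p * t) / R * R powr (- s)) * w + (R powr (p * t) / R * R powr (- s * (1 - q))) * Y)"
        unfolding regroup k_def[symmetric] powr_powr ..
      also have "\<dots> = k * (w + R powr (q * s) * Y)"
        unfolding pw by simp
      finally show ?thesis using R by (simp add: y_def mult.commute)
    qed
    have y_le: "y \<le> k * (\<beta> * w + x / (2 * k\<^sup>2))"
    proof -
      have "y \<le> real (m + 2) * (l / R) * (\<beta> * R powr (- t) * measure lborel S + (\<beta> * R powr (- t)) powr (1 - p) * X) * R powr (q * s)"
        unfolding y_def using energy(2) by (intro mult_right_mono) auto
      also have "\<dots> \<le> real (m + 2) * (l / R) * (\<beta> * R powr (- t) * w + (\<beta> * R powr (- t)) powr (1 - p) * X) * R powr (q * s)"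
        using vol kR \<beta>(1) unfolding w_def by (intro mult_right_mono mult_left_mono add_right_mono) simp_all
      also have "\<dots> = k * (\<beta> * (R powr (q * s) / R * R powr (- t)) * w
          + \<beta> powr (1 - p) * ((R powr (q * s) / R * R powr (- t * (1 - p))) * X))"
        unfolding regroup k_def[symmetric] \<beta>_split powr_powr by (simp only: mult_ac)
      also have "\<dots> = k * (\<beta> * w + \<beta> powr (1 - p) * (R powr (p * t) * X))"
        unfolding pw by simp
      finally show ?thesis using R \<beta>(2) by (simp add: x_def mult.commute)
    qed
    have "x \<le> 2 * (k + k\<^sup>2 * \<beta>) * w" "y \<le> (1 + 2 * k * \<beta>) * w"
      using absorb_coupled_inequalities[OF k x_le y_le] by auto
    moreover have "2 * (k + k\<^sup>2 * \<beta>) * w \<le> C * R powr N" "(1 + 2 * k * \<beta>) * w \<le> C * R powr N"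
      unfolding w_def C_def mult.assoc[symmetric] by (intro mult_right_mono; simp)+
    ultimately have xy: "x \<le> C * R powr N" "y \<le> C * R powr N" by auto
    have X: "X \<le> C * R powr (N - p * t)" and Y: "Y \<le> C * R powr (N - q * s)"
      using xy R unfolding x_def y_def by (simp_all add: powr_diff field_simps)
    have A_le: "(LINT x:A|lborel. f x) \<le> (\<integral>x. f x * \<phi> x ^ j \<partial>lborel)"
      if "continuous_on \<Omega> f" "\<And>x. 0 \<le> f x" "0 < j" for f :: "real^'n \<Rightarrow> real" and j
      unfolding set_lebesgue_integral_def
    proof (rule integral_mono_AE')
      show "integrable lborel (\<lambda>x. f x * \<phi> x ^ j)"
        by (rule cutoff_power_integrable[OF \<Omega> S \<phi>(1) \<phi>0 that(1,3)])
      show "AE x in lborel. indicat_real A x *\<^sub>R f x \<le> f x * \<phi> x ^ j"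
      proof (rule AE_I2)
        fix x show "indicat_real A x *\<^sub>R f x \<le> f x * \<phi> x ^ j"
          using that(2)[of x] \<phi>(2)[of x] \<phi>1[of x] by (cases "x \<in> A") auto
      qed
      show "AE x in lborel. 0 \<le> f x * \<phi> x ^ j" using that(2) \<phi>(2) by simp
    qed
    have "continuous_on \<Omega> (grad u1)" "continuous_on \<Omega> (grad u2)"
      using super by (auto intro!: continuous_on_grad simp: supersolution_def C2_on_def)
    then have "continuous_on \<Omega> (\<lambda>x. norm (grad u2 x) powr p)" "continuous_on \<Omega> (\<lambda>x. norm (grad u1 x) powr q)"
      using pq by (auto intro!: continuous_on_powr' continuous_on_norm)
    then have "(LINT x:A|lborel. norm (grad u2 x) powr p) \<le> X" "(LINT x:A|lborel. norm (grad u1 x) powr q) \<le> Y"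
      unfolding X_def Y_def
      using A_le[of "\<lambda>x. norm (grad u2 x) powr p" "m + 2"] A_le[of "\<lambda>x. norm (grad u1 x) powr q" "m + 1"]
      by simp_all
    then show "(LINT x:{x. b * R\<^sup>2 \<le> x \<bullet> x \<and> x \<bullet> x \<le> c * R\<^sup>2}|lborel. norm (grad u2 x) powr p)
          \<le> C * R powr (real CARD('n) - p * (q + 1) / (p * q - 1)) \<and>
        (LINT x:{x. b * R\<^sup>2 \<le> x \<bullet> x \<and> x \<bullet> x \<le> c * R\<^sup>2}|lborel. norm (grad u1 x) powr q)
          \<le> C * R powr (real CARD('n) - q * (p + 1) / (p * q - 1))"
      using X Y unfolding exps by (simp add: A_def N_def)
  qed
qed

lemma le_norm_iff_inner:
  fixes x :: "'a::real_inner"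
  assumes "0 \<le> r"
  shows "r \<le> norm x \<longleftrightarrow> r\<^sup>2 \<le> x \<bullet> x" "norm x \<le> r \<longleftrightarrow> x \<bullet> x \<le> r\<^sup>2"
  using assms by (simp_all add: power2_norm_eq_inner[symmetric] power_mono_iff)

text \<open>
  The inner radius \<open>\<theta> R\<close> is free because in an exterior domain the distance from the annulus to the
  boundary may be an arbitrarily small fraction of \<open>R\<close>, and the constant deteriorates as
  \<open>\<theta>\<close> approaches \<open>1 / 2\<close>.\<close>
corollary annulus_energy_estimate:
  fixes p q \<theta> :: real
  assumes pq: "1 \<le> q" "1 < p" "1 < p * q" and \<theta>: "0 < \<theta>" "\<theta> < 1 / 2"
  obtains C where "0 < C"
    "\<And>R \<Omega> (u1 :: real^'n::finite \<Rightarrow> real) u2. \<lbrakk>0 < R; open \<Omega>; supersolution p q \<Omega> u1 u2;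
        {x. \<theta> * R \<le> norm x \<and> norm x \<le> 2 * R} \<subseteq> \<Omega>\<rbrakk> \<Longrightarrow>
      annulus_integral R (\<lambda>x. norm (grad u2 x) powr p)
        \<le> C * R powr (real CARD('n) - p * (q + 1) / (p * q - 1)) \<and>
      annulus_integral R (\<lambda>x. norm (grad u1 x) powr q)
        \<le> C * R powr (real CARD('n) - q * (p + 1) / (p * q - 1))"
proof -
  have "\<theta>\<^sup>2 < (1 / 2)\<^sup>2" using \<theta> by (intro power_strict_mono) auto
  then have "\<theta>\<^sup>2 < 1 / 4" by (simp add: power2_eq_square)
  then obtain C where C: "0 < C"
    "\<And>R \<Omega> (u1 :: real^'n \<Rightarrow> real) u2. \<lbrakk>0 < R; open \<Omega>; supersolution p q \<Omega> u1 u2;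
        {x. \<theta>\<^sup>2 * R\<^sup>2 \<le> x \<bullet> x \<and> x \<bullet> x \<le> 4 * R\<^sup>2} \<subseteq> \<Omega>\<rbrakk> \<Longrightarrow>
      (LINT x:{x. 1 / 4 * R\<^sup>2 \<le> x \<bullet> x \<and> x \<bullet> x \<le> 9 / 4 * R\<^sup>2}|lborel. norm (grad u2 x) powr p)
        \<le> C * R powr (real CARD('n) - p * (q + 1) / (p * q - 1)) \<and>
      (LINT x:{x. 1 / 4 * R\<^sup>2 \<le> x \<bullet> x \<and> x \<bullet> x \<le> 9 / 4 * R\<^sup>2}|lborel. norm (grad u1 x) powr q)
        \<le> C * R powr (real CARD('n) - q * (p + 1) / (p * q - 1))"
    using rescaled_energy_estimate[OF pq, of "\<theta>\<^sup>2" "1 / 4" "9 / 4" 4, where 'n = 'n] by auto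
  show thesis
  proof (rule that[OF C(1)])
    fix R :: real and \<Omega> :: "(real^'n) set" and u1 u2 :: "real^'n \<Rightarrow> real"
    assume R: "0 < R" and hyps: "open \<Omega>" "supersolution p q \<Omega> u1 u2"
      and sub: "{x. \<theta> * R \<le> norm x \<and> norm x \<le> 2 * R} \<subseteq> \<Omega>"
    have "{x::real^'n. \<theta> * R \<le> norm x \<and> norm x \<le> 2 * R} = {x. \<theta>\<^sup>2 * R\<^sup>2 \<le> x \<bullet> x \<and> x \<bullet> x \<le> 4 * R\<^sup>2}"
      using R \<theta> by (simp add: le_norm_iff_inner power_mult_distrib)
    moreover have "{x::real^'n. R / 2 \<le> norm x \<and> norm x \<le> 3 * R / 2}
        = {x. 1 / 4 * R\<^sup>2 \<le> x \<bullet> x \<and> x \<bullet> x \<le> 9 / 4 * R\<^sup>2}"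
      using R le_norm_iff_inner(1)[of "R / 2" "_ :: real^'n"] le_norm_iff_inner(2)[of "3 * R / 2" "_ :: real^'n"]
      by (simp add: power_mult_distrib power_divide)
    ultimately show "annulus_integral R (\<lambda>x. norm (grad u2 x) powr p)
        \<le> C * R powr (real CARD('n) - p * (q + 1) / (p * q - 1)) \<and>
      annulus_integral R (\<lambda>x. norm (grad u1 x) powr q)
        \<le> C * R powr (real CARD('n) - q * (p + 1) / (p * q - 1))"
      using C(2)[OF R hyps] sub unfolding annulus_integral_def by simp
  qed
qed

section \<open>Entire solutions\<close>

text \<open>
  For a fixed box, its integral is at most the integral over every large ball, hence at most the
  limit 0; a nonnegative continuous function with zero integral over a box vanishes on it.\<close>
lemma continuous_eq_0_of_ball_integrals_le:
  fixes f :: "real^'n::finite \<Rightarrow> real"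
  assumes f: "continuous_on UNIV f" "\<And>x. 0 \<le> f x"
    and le: "\<And>R. 0 < R \<Longrightarrow> (LINT x:cball 0 R|lborel. f x) \<le> B R" and B: "(B \<longlongrightarrow> 0) at_top"
  shows "f x = 0"
proof -
  have int: "integrable lborel (\<lambda>x. indicat_real K x *\<^sub>R f x)" if "compact K" for K
    using that f(1) by (intro borel_integrable_compact) (auto intro: continuous_on_subset)
  obtain v :: "real^'n" where v: "cball 0 (norm x + 1) \<subseteq> cbox (- v) v"
    using bounded_subset_cbox_symmetric[OF bounded_cball] by blast
  have "ball 0 (norm x + 1) \<subseteq> box (- v) v"
    using interior_mono[OF v] by (simp add: interior_cbox)
  then have ne: "box (- v) v \<noteq> {}"
    by (metis add_nonneg_pos ball_eq_empty norm_ge_zero not_le subset_empty zero_less_one)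
  obtain r where r: "0 < r" "\<And>y. y \<in> cbox (- v) v \<Longrightarrow> norm y \<le> r"
    using bounded_pos[THEN iffD1, OF bounded_cbox[of "- v" v]] by blast
  define I where "I = (LINT y:cbox (- v) v|lborel. f y)"
  have "I \<le> B R" if "r \<le> R" for R
  proof -
    have "I \<le> (LINT y:cball 0 R|lborel. f y)"
      unfolding I_def set_lebesgue_integral_def
    proof (rule integral_mono)
      fix y
      have "y \<in> cball 0 R" if "y \<in> cbox (- v) v" using r(2)[OF that] \<open>r \<le> R\<close> by simp
      then show "indicat_real (cbox (- v) v) y *\<^sub>R f y \<le> indicat_real (cball 0 R) y *\<^sub>R f y"
        using f(2)[of y] by (auto simp: indicator_def)
    qed (use int in auto)
    also have "\<dots> \<le> B R" using that r(1) by (intro le) auto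
    finally show ?thesis .
  qed
  then have "I \<le> 0"
    by (intro tendsto_lowerbound[OF B]) (auto simp: eventually_at_top_linorder)
  moreover have "0 \<le> I"
    unfolding I_def set_lebesgue_integral_def using f(2) by (intro Bochner_Integration.integral_nonneg) auto
  ultimately have "I = 0" by simp
  moreover have "set_integrable lborel (cbox (- v) v) f"
    unfolding set_integrable_def by (rule int) simp
  ultimately have "(f has_integral 0) (cbox (- v) v)"
    using set_borel_integral_eq_integral[of "cbox (- v) v" f] has_integral_integral
    by (metis I_def)
  moreover have "x \<in> cbox (- v) v" using v by auto
  ultimately show "f x = 0"
    using f ne by (intro has_integral_0_cbox_imp_0[of "- v" v f]) (auto intro: continuous_on_subset)
qed

lemma constant_on_UNIV_if_grad_eq_0:
  fixes u :: "real^'n::finite \<Rightarrow> real"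
  assumes "C1_on UNIV u" "\<And>x. grad u x = 0"
  shows "u constant_on UNIV"
proof -
  have "(u has_derivative (\<lambda>h. 0)) (at x)" for x
    using has_derivative_grad[of u x] assms by (simp add: C1_on_def)
  then show ?thesis
    unfolding constant_on_def using has_derivative_zero_constant[of UNIV u] by auto
qed

text \<open>
  The energy of \<open>u2\<close> on a ball of radius \<open>R\<close> is at most a constant times a negative power of \<open>R\<close>,
  so \<open>\<nabla> u2 = 0\<close>; then \<open>|\<nabla> u1|^q = - \<Delta> u2 = 0\<close>.\<close>
theorem solutions_constant_if_subcritical:
  fixes p q :: real and u1 u2 :: "real^'n::finite \<Rightarrow> real"
  assumes pq: "1 \<le> q" "1 < p" "1 < p * q"
    and sub: "real CARD('n) < p * (q + 1) / (p * q - 1)"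
    and sol: "solution p q UNIV u1 u2"
  shows "u1 constant_on UNIV" "u2 constant_on UNIV"
proof -
  define e where "e = real CARD('n) - p * (q + 1) / (p * q - 1)"
  have e: "e < 0" using sub by (simp add: e_def)
  have C1: "C1_on UNIV u1" "C1_on UNIV u2" using sol by (auto simp: solution_def C2_on_def)
  have eq: "- laplacian u2 x = norm (grad u1 x) powr q" for x
    using sol by (simp add: solution_def)
  have super: "supersolution p q UNIV u1 u2" using sol by (simp add: solution_def supersolution_def)
  have levels: "(-1::real) < 0" "(1::real) < 4" "(0::real) < 4" by simp_all
  have "\<exists>C. \<forall>R>0. (LINT x:cball 0 R|lborel. norm (grad u2 x) powr p) \<le> C * R powr e"
  proof (rule rescaled_energy_estimate[OF pq levels, where 'n = 'n])
    fix C :: real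
    assume est: "\<And>R \<Omega> (v1 :: real^'n \<Rightarrow> real) v2. \<lbrakk>0 < R; open \<Omega>; supersolution p q \<Omega> v1 v2;
        {x. -1 * R\<^sup>2 \<le> x \<bullet> x \<and> x \<bullet> x \<le> 4 * R\<^sup>2} \<subseteq> \<Omega>\<rbrakk> \<Longrightarrow>
      (LINT x:{x. 0 * R\<^sup>2 \<le> x \<bullet> x \<and> x \<bullet> x \<le> 1 * R\<^sup>2}|lborel. norm (grad v2 x) powr p)
        \<le> C * R powr (real CARD('n) - p * (q + 1) / (p * q - 1)) \<and>
      (LINT x:{x. 0 * R\<^sup>2 \<le> x \<bullet> x \<and> x \<bullet> x \<le> 1 * R\<^sup>2}|lborel. norm (grad v1 x) powr q)
        \<le> C * R powr (real CARD('n) - q * (p + 1) / (p * q - 1))"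
    have "(LINT x:cball 0 R|lborel. norm (grad u2 x) powr p) \<le> C * R powr e" if R: "0 < R" for R
    proof -
      have "cball 0 R = {x::real^'n. 0 * R\<^sup>2 \<le> x \<bullet> x \<and> x \<bullet> x \<le> 1 * R\<^sup>2}"
      proof (rule set_eqI)
        fix x :: "real^'n"
        show "x \<in> cball 0 R \<longleftrightarrow> x \<in> {x. 0 * R\<^sup>2 \<le> x \<bullet> x \<and> x \<bullet> x \<le> 1 * R\<^sup>2}"
          using le_norm_iff_inner(2)[of R x] R by simp
      qed
      then show ?thesis
        using conjunct1[OF est[OF R open_UNIV super subset_UNIV]] by (simp only: e_def)
    qed
    then show ?thesis by blast
  qed
  then obtain C where C: "\<And>R. 0 < R \<Longrightarrow> (LINT x:cball 0 R|lborel. norm (grad u2 x) powr p) \<le> C * R powr e"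
    by blast
  have g2: "grad u2 x = 0" for x
  proof -
    have "norm (grad u2 x) powr p = 0"
    proof (rule continuous_eq_0_of_ball_integrals_le[where f = "\<lambda>x. norm (grad u2 x) powr p" and B = "\<lambda>R. C * R powr e"])
      show "continuous_on UNIV (\<lambda>x. norm (grad u2 x) powr p)"
        using pq(2) C1(2) by (intro continuous_on_powr' continuous_on_norm continuous_on_grad continuous_intros) auto
      show "(LINT x:cball 0 R|lborel. norm (grad u2 x) powr p) \<le> C * R powr e" if "0 < R" for R
        using that by (rule C)
      show "((\<lambda>R. C * R powr e) \<longlongrightarrow> 0) at_top"
        using tendsto_mult_right_zero[OF tendsto_neg_powr[OF e filterlim_ident], of C] by simp
    qed simp
    then show ?thesis by simp
  qed
  have "partial_deriv i u2 x = 0" for i x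
    using arg_cong[OF g2[of x], of "\<lambda>v. v $ i"] by simp
  then have "partial_deriv i u2 = (\<lambda>x. 0)" for i
    by (rule ext)
  moreover have "partial_deriv i (\<lambda>x. 0) x = 0" for i and x :: "real^'n"
    by (simp add: partial_deriv_def)
  ultimately have "laplacian u2 x = 0" for x by (simp add: laplacian_def)
  then have g1: "grad u1 x = 0" for x using eq[of x] by simp
  show "u1 constant_on UNIV" "u2 constant_on UNIV"
    using constant_on_UNIV_if_grad_eq_0 C1 g1 g2 by blast+
qed

section \<open>Local estimates and the Liouville property\<close>

theorem theorem6p2:
  fixes p q N :: real
  defines "N \<equiv> real CARD('n::finite)"
  assumes "CARD('n) \<ge> 3" and "q \<ge> 1" and "p \<ge> q" and "p * q > 1"
  shows
    "(\<exists>C>0. \<forall>r0>0. \<forall>(u1 :: real^'n \<Rightarrow> real) u2.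
        supersolution p q (ball 0 r0 - {0}) u1 u2 \<longrightarrow>
        (\<forall>R. 0 < R \<and> R < r0 / 2 \<longrightarrow>
          annulus_integral R (\<lambda>x. norm (grad u2 x) powr p)
            \<le> C * R powr (N - p * (q + 1) / (p * q - 1)) \<and>
          annulus_integral R (\<lambda>x. norm (grad u1 x) powr q)
            \<le> C * R powr (N - q * (p + 1) / (p * q - 1))))
     \<and>
     (\<forall>\<kappa>>2. \<exists>C>0. \<forall>r0>0. \<forall>(u1 :: real^'n \<Rightarrow> real) u2.
        supersolution p q (- cball 0 r0) u1 u2 \<longrightarrow>
        (\<forall>R. R > \<kappa> * r0 \<longrightarrow>
          annulus_integral R (\<lambda>x. norm (grad u2 x) powr p)
            \<le> C * R powr (N - p * (q + 1) / (p * q - 1)) \<and>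
          annulus_integral R (\<lambda>x. norm (grad u1 x) powr q)
            \<le> C * R powr (N - q * (p + 1) / (p * q - 1))))
     \<and>
     ((N - 1) * p * q < max (N + p) (N + q) \<longrightarrow>
       (\<forall>(u1 :: real^'n \<Rightarrow> real) u2. solution p q UNIV u1 u2 \<longrightarrow>
          u1 constant_on UNIV \<and> u2 constant_on UNIV))"
proof -
  \<comment> \<open>If \<open>p = 1\<close>, then \<open>q = 1\<close> and \<open>pq = 1\<close>.\<close>
  have "p \<noteq> 1" using assms(3-5) by auto
  then have pq: "1 \<le> q" "1 < p" "1 < p * q" using assms(3-5) by auto
  show ?thesis
  proof (intro conjI allI impI)
    obtain C where C: "0 < C"
      "\<And>R \<Omega> (u1 :: real^'n \<Rightarrow> real) u2. \<lbrakk>0 < R; open \<Omega>; supersolution p q \<Omega> u1 u2;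
          {x. 1 / 4 * R \<le> norm x \<and> norm x \<le> 2 * R} \<subseteq> \<Omega>\<rbrakk> \<Longrightarrow>
        annulus_integral R (\<lambda>x. norm (grad u2 x) powr p) \<le> C * R powr (N - p * (q + 1) / (p * q - 1)) \<and>
        annulus_integral R (\<lambda>x. norm (grad u1 x) powr q) \<le> C * R powr (N - q * (p + 1) / (p * q - 1))"
      unfolding N_def using annulus_energy_estimate[OF pq, of "1 / 4", where 'n = 'n] by auto
    show "\<exists>C>0. \<forall>r0>0. \<forall>(u1 :: real^'n \<Rightarrow> real) u2.
        supersolution p q (ball 0 r0 - {0}) u1 u2 \<longrightarrow>
        (\<forall>R. 0 < R \<and> R < r0 / 2 \<longrightarrow>
          annulus_integral R (\<lambda>x. norm (grad u2 x) powr p)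
            \<le> C * R powr (N - p * (q + 1) / (p * q - 1)) \<and>
          annulus_integral R (\<lambda>x. norm (grad u1 x) powr q)
            \<le> C * R powr (N - q * (p + 1) / (p * q - 1)))"
    proof (intro exI[of _ C] conjI[OF C(1)] allI impI)
      fix r0 R :: real and u1 u2 :: "real^'n \<Rightarrow> real"
      assume "supersolution p q (ball 0 r0 - {0}) u1 u2" "0 < R \<and> R < r0 / 2"
      then show "annulus_integral R (\<lambda>x. norm (grad u2 x) powr p) \<le> C * R powr (N - p * (q + 1) / (p * q - 1)) \<and>
          annulus_integral R (\<lambda>x. norm (grad u1 x) powr q) \<le> C * R powr (N - q * (p + 1) / (p * q - 1))"
        by (intro C(2)[where \<Omega> = "ball 0 r0 - {0}"]) auto
    qed
  next
    fix \<kappa> :: real assume \<kappa>: "2 < \<kappa>"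
    then obtain C where C: "0 < C"
      "\<And>R \<Omega> (u1 :: real^'n \<Rightarrow> real) u2. \<lbrakk>0 < R; open \<Omega>; supersolution p q \<Omega> u1 u2;
          {x. 1 / \<kappa> * R \<le> norm x \<and> norm x \<le> 2 * R} \<subseteq> \<Omega>\<rbrakk> \<Longrightarrow>
        annulus_integral R (\<lambda>x. norm (grad u2 x) powr p) \<le> C * R powr (N - p * (q + 1) / (p * q - 1)) \<and>
        annulus_integral R (\<lambda>x. norm (grad u1 x) powr q) \<le> C * R powr (N - q * (p + 1) / (p * q - 1))"
      unfolding N_def using annulus_energy_estimate[OF pq, of "1 / \<kappa>", where 'n = 'n] by auto
    show "\<exists>C>0. \<forall>r0>0. \<forall>(u1 :: real^'n \<Rightarrow> real) u2.
        supersolution p q (- cball 0 r0) u1 u2 \<longrightarrow>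
        (\<forall>R. R > \<kappa> * r0 \<longrightarrow>
          annulus_integral R (\<lambda>x. norm (grad u2 x) powr p)
            \<le> C * R powr (N - p * (q + 1) / (p * q - 1)) \<and>
          annulus_integral R (\<lambda>x. norm (grad u1 x) powr q)
            \<le> C * R powr (N - q * (p + 1) / (p * q - 1)))"
    proof (intro exI[of _ C] conjI[OF C(1)] allI impI)
      fix r0 R :: real and u1 u2 :: "real^'n \<Rightarrow> real"
      assume r0: "0 < r0" and super: "supersolution p q (- cball 0 r0) u1 u2" and R: "\<kappa> * r0 < R"
      have "0 < \<kappa> * r0" using \<kappa> r0 by simp
      then have "0 < R" using R by linarith
      moreover have "r0 < 1 / \<kappa> * R" using R \<kappa> by (simp add: field_simps)
      then have "{x::real^'n. 1 / \<kappa> * R \<le> norm x \<and> norm x \<le> 2 * R} \<subseteq> - cball 0 r0" by auto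
      ultimately show "annulus_integral R (\<lambda>x. norm (grad u2 x) powr p) \<le> C * R powr (N - p * (q + 1) / (p * q - 1)) \<and>
          annulus_integral R (\<lambda>x. norm (grad u1 x) powr q) \<le> C * R powr (N - q * (p + 1) / (p * q - 1))"
        using super by (intro C(2)[where \<Omega> = "- cball 0 r0"]) auto
    qed
  next
    fix u1 u2 :: "real^'n \<Rightarrow> real"
    assume crit: "(N - 1) * p * q < max (N + p) (N + q)" and sol: "solution p q UNIV u1 u2"
    \<comment> \<open>The condition is \<open>N (p q - 1) < p (q + 1)\<close> in disguise.\<close>
    have "(N - 1) * p * q < N + p" using crit assms(4) by (simp add: max_def split: if_splits)
    then have "real CARD('n) < p * (q + 1) / (p * q - 1)"
      using pq(3) unfolding N_def by (simp add: field_simps)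
    then show "u1 constant_on UNIV" "u2 constant_on UNIV"
      using solutions_constant_if_subcritical[OF pq _ sol] by auto
  qed
qed

end
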